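(* In metric $f(R)$ gravity with $f_{,RR}\neq0$, a homogeneous (spatially flat) FLRW interior with non-vanishing Ricci scalar cannot be matched to a Ricci-flat exterior across a regular timelike hypersurface $\Sigma$. That is: let the interior be a region of the spacetime with metric $ds_-^2=-dt^2+a^2(t)(dr^2+r^2d\Omega^2)$, $a>0$ smooth, whose Ricci scalar satisfies $R_-(t)\neq0$ for all $t$, and let the exterior be a four-dimensional Lorentzian manifold whose Ricci tensor vanishes identically. Then there is no (nonempty) timelike hypersurface $\Sigma$, bounding both the interior and the exterior, across which the regular junction conditions of metric $f(R)$ gravity with $f_{,RR}\neq 0$ hold.
   Context: Let $\gamma_{ij}$ denote the induced metric on $\Sigma$, $K_{ij}$ its extrinsic curvature, $n^\mu$ the unit normal, and $[X]^+_-=X^+|_\Sigma-X^-|_\Sigma$ the jump of a quantity across $\Sigma$ between the exterior ($+$) and interior ($-$) sides, whose boundaries are identified along $\Sigma$. The regular junction conditions (no distributional source on $\Sigma$) of metric $f(R)$ gravity with $f_{,RR}\neq0$ on $\Sigma$ are $$[\gamma_{ij}]^+_-=0,\quad [K_{ij}]^+_-=0,\quad [R]^+_-=0,\quad [n^\mu\nabla_\mu R]^+_-=0,$$ where $R$ is the Ricci scalar of the respective metric. For the interior, $R_-(t)=6\left(\frac{\ddot a}{a}+\frac{\dot a^2}{a^2}\right)$. *)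

theory Defs
  imports "HOL-Analysis.Analysis"
begin

section \<open>Smooth functions on open subsets of Euclidean spaces\<close>

text \<open>Only meant for open sets \<open>S\<close>: the derivatives are taken in the full space.\<close>

primrec Ck_on :: "nat \<Rightarrow> 'a::euclidean_space set \<Rightarrow> ('a \<Rightarrow> 'b::real_normed_vector) \<Rightarrow> bool" where
  "Ck_on 0 S f \<longleftrightarrow> continuous_on S f"
| "Ck_on (Suc k) S f \<longleftrightarrow> (\<forall>x\<in>S. f differentiable (at x)) \<and>
     (\<forall>b\<in>Basis. Ck_on k S (\<lambda>x. frechet_derivative f (at x) b))"

definition smooth_on :: "'a::euclidean_space set \<Rightarrow> ('a \<Rightarrow> 'b::real_normed_vector) \<Rightarrow> bool" where
  "smooth_on S f \<longleftrightarrow> (\<forall>k. Ck_on k S f)"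

definition pd :: "'n::finite \<Rightarrow> (real^'n \<Rightarrow> 'b::real_normed_vector) \<Rightarrow> real^'n \<Rightarrow> 'b" where
  "pd i f x = frechet_derivative f (at x) (axis i 1)"


section \<open>Curvature of a metric in coordinates\<close>

definition christoffel ::
  "(real^'n \<Rightarrow> real^'n^'n) \<Rightarrow> real^'n \<Rightarrow> 'n \<Rightarrow> 'n \<Rightarrow> 'n \<Rightarrow> real" where
  "christoffel g x k i j = (1/2) * (\<Sum>l\<in>UNIV. matrix_inv (g x) $ k $ l *
      (pd i (\<lambda>y. g y $ j $ l) x + pd j (\<lambda>y. g y $ i $ l) x - pd l (\<lambda>y. g y $ i $ j) x))"

text \<open>\<open>riemann g x k l i j\<close> is
  $R^k{}_{lij} = \partial_i \Gamma^k_{jl} - \partial_j \Gamma^k_{il}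
    + \Gamma^k_{im}\Gamma^m_{jl} - \Gamma^k_{jm}\Gamma^m_{il}$.\<close>

definition riemann ::
  "(real^'n \<Rightarrow> real^'n^'n) \<Rightarrow> real^'n \<Rightarrow> 'n \<Rightarrow> 'n \<Rightarrow> 'n \<Rightarrow> 'n \<Rightarrow> real" where
  "riemann g x k l i j =
     pd i (\<lambda>y. christoffel g y k j l) x - pd j (\<lambda>y. christoffel g y k i l) x
     + (\<Sum>m\<in>UNIV. christoffel g x k i m * christoffel g x m j l
                  - christoffel g x k j m * christoffel g x m i l)"

definition ricci :: "(real^'n \<Rightarrow> real^'n^'n) \<Rightarrow> real^'n \<Rightarrow> 'n \<Rightarrow> 'n \<Rightarrow> real" where
  "ricci g x i j = (\<Sum>k\<in>UNIV. riemann g x k i k j)"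

definition ricci_scalar :: "(real^'n \<Rightarrow> real^'n^'n) \<Rightarrow> real^'n \<Rightarrow> real" where
  "ricci_scalar g x = (\<Sum>i\<in>UNIV. \<Sum>j\<in>UNIV. matrix_inv (g x) $ i $ j * ricci g x i j)"

text \<open>Symmetric of signature $(-,+,\dots,+)$: there is an orthonormal frame (the columns of \<open>P\<close>),
  the \<open>k\<close>-th vector of which is timelike.\<close>

definition lorentzian_form :: "real^'n^'n \<Rightarrow> bool" where
  "lorentzian_form A \<longleftrightarrow> transpose A = A \<and>
     (\<exists>(P :: real^'n^'n) k. transpose P ** A ** P = (\<chi> i j. if i \<noteq> j then 0 else if i = k then -1 else 1))"


section \<open>Manifolds\<close>

type_synonym ('p, 'n) chart = "'p set \<times> ('p \<Rightarrow> real^'n)"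

record ('p, 'n::finite) manifold =
  mtop :: "'p topology"
  atlas :: "('p, 'n) chart set"

text \<open>The metric is given by its component matrix in each chart of the atlas.\<close>

record ('p, 'n::finite) spacetime = "('p, 'n) manifold" +
  gmetric :: "('p, 'n) chart \<Rightarrow> real^'n \<Rightarrow> real^'n^'n"

text \<open>The expression of a map \<open>e\<close> in a chart \<open>k\<close> of its source and a chart \<open>c\<close> of its target, and
  the set of coordinates on which it is meaningful.\<close>

definition coord_rep ::
  "('s, 'm) chart \<Rightarrow> ('p, 'n) chart \<Rightarrow> ('s \<Rightarrow> 'p) \<Rightarrow> real^'m \<Rightarrow> real^'n" where
  "coord_rep k c e = snd c \<circ> e \<circ> inv_into (fst k) (snd k)"

definition coord_dom ::
  "('s, 'm) chart \<Rightarrow> ('p, 'n) chart \<Rightarrow> ('s \<Rightarrow> 'p) \<Rightarrow> (real^'m) set" where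
  "coord_dom k c e = snd k ` (fst k \<inter> e -` fst c)"

definition smooth_manifold :: "('p, 'n::finite, 'z) manifold_scheme \<Rightarrow> bool" where
  "smooth_manifold M \<longleftrightarrow>
     Hausdorff_space (mtop M) \<and> second_countable (mtop M) \<and>
     \<Union> (fst ` atlas M) = topspace (mtop M) \<and>
     (\<forall>c\<in>atlas M. openin (mtop M) (fst c) \<and> open (snd c ` fst c) \<and>
        homeomorphic_map (subtopology (mtop M) (fst c)) (top_of_set (snd c ` fst c)) (snd c)) \<and>
     (\<forall>c\<in>atlas M. \<forall>d\<in>atlas M. smooth_on (coord_dom c d id) (coord_rep c d id))"

definition lorentzian_manifold :: "('p, 'n::finite) spacetime \<Rightarrow> bool" where
  "lorentzian_manifold M \<longleftrightarrow>
     smooth_manifold M \<and>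
     (\<forall>c\<in>atlas M. smooth_on (snd c ` fst c) (gmetric M c) \<and>
        (\<forall>x\<in>snd c ` fst c. lorentzian_form (gmetric M c x))) \<and>
     (\<forall>c\<in>atlas M. \<forall>d\<in>atlas M. \<forall>x\<in>coord_dom c d id. \<forall>u v.
        u \<bullet> (gmetric M c x *v v) =
        frechet_derivative (coord_rep c d id) (at x) u \<bullet>
          (gmetric M d (coord_rep c d id x) *v frechet_derivative (coord_rep c d id) (at x) v))"

definition ricci_flat_on :: "('p, 'n::finite) spacetime \<Rightarrow> 'p set \<Rightarrow> bool" where
  "ricci_flat_on M E \<longleftrightarrow>
     (\<forall>c\<in>atlas M. \<forall>p\<in>fst c \<inter> E. \<forall>i j. ricci (gmetric M c) (snd c p) i j = 0)"

text \<open>The Ricci scalar does not depend on the chart, so any chart around the point will do.\<close>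

definition scalar_curvature :: "('p, 'n::finite) spacetime \<Rightarrow> 'p \<Rightarrow> real" where
  "scalar_curvature M p =
     (let c = (SOME c. c \<in> atlas M \<and> p \<in> fst c) in ricci_scalar (gmetric M c) (snd c p))"


section \<open>Hypersurfaces\<close>

text \<open>In the following, \<open>X\<close> is a parametrised hypersurface in coordinates, \<open>y\<close> a parameter value.\<close>

definition first_form ::
  "(real^'n \<Rightarrow> real^'n^'n) \<Rightarrow> (real^'m \<Rightarrow> real^'n) \<Rightarrow> real^'m \<Rightarrow> real^'m^'m" where
  "first_form g X y = (\<chi> i j. pd i X y \<bullet> (g (X y) *v pd j X y))"

definition unit_normal ::
  "(real^'n \<Rightarrow> real^'n^'n) \<Rightarrow> (real^'m \<Rightarrow> real^'n) \<Rightarrow> real^'m \<Rightarrow> real^'n \<Rightarrow> bool" where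
  "unit_normal g X y n \<longleftrightarrow>
     (\<forall>i. n \<bullet> (g (X y) *v pd i X y) = 0) \<and> n \<bullet> (g (X y) *v n) = 1"

text \<open>The extrinsic curvature $K_{ij} = e_i^\mu e_j^\nu \nabla_\mu n_\nu$ of the tangent vectors
  $e_i = \partial_i X$. Differentiating $n_\nu e_j^\nu = 0$ along the hypersurface turns this into
  $K_{ij} = - n_\nu (\partial_i \partial_j X^\nu + \Gamma^\nu_{\alpha\beta} e_i^\alpha e_j^\beta)$,
  in which the normal is not differentiated.\<close>

definition extrinsic_curvature ::
  "(real^'n \<Rightarrow> real^'n^'n) \<Rightarrow> (real^'m \<Rightarrow> real^'n) \<Rightarrow> real^'m \<Rightarrow> real^'n \<Rightarrow> real^'m^'m" where
  "extrinsic_curvature g X y n = (\<chi> i j.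
     - (n \<bullet> (g (X y) *v (pd i (pd j X) y +
          (\<chi> \<nu>. \<Sum>\<alpha>\<in>UNIV. \<Sum>\<beta>\<in>UNIV.
              christoffel g (X y) \<nu> \<alpha> \<beta> * pd i X y $ \<alpha> * pd j X y $ \<beta>)))))"

definition smooth_embedding ::
  "('s, 'm::finite, 'y) manifold_scheme \<Rightarrow> ('p, 'n::finite, 'z) manifold_scheme \<Rightarrow> ('s \<Rightarrow> 'p) \<Rightarrow> bool" where
  "smooth_embedding S M e \<longleftrightarrow>
     embedding_map (mtop S) (mtop M) e \<and>
     (\<forall>k\<in>atlas S. \<forall>c\<in>atlas M. smooth_on (coord_dom k c e) (coord_rep k c e) \<and>
        (\<forall>y\<in>coord_dom k c e. inj (frechet_derivative (coord_rep k c e) (at y))))"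

text \<open>The image of \<open>S\<close> is part of the smooth boundary of the open region \<open>V\<close>: near each of
  its points it is the zero set of a function \<open>F\<close> with non-vanishing differential,
  and \<open>V\<close> is exactly the side \<open>F < 0\<close>.\<close>

definition bounds ::
  "('s, 'm::finite, 'y) manifold_scheme \<Rightarrow> ('s \<Rightarrow> 'p) \<Rightarrow> ('p, 'n::finite, 'z) manifold_scheme \<Rightarrow> 'p set \<Rightarrow> bool" where
  "bounds S e M V \<longleftrightarrow>
     (\<forall>p\<in>topspace (mtop S). \<exists>W F. openin (mtop M) W \<and> e p \<in> W \<and>
        e ` topspace (mtop S) \<inter> W = {q\<in>W. F q = (0::real)} \<and>
        V \<inter> W = {q\<in>W. F q < 0} \<and>
        (\<forall>c\<in>atlas M. smooth_on (snd c ` (fst c \<inter> W)) (F \<circ> inv_into (fst c) (snd c)) \<and>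
           (\<forall>q\<in>fst c \<inter> W. F q = 0 \<longrightarrow>
              frechet_derivative (F \<circ> inv_into (fst c) (snd c)) (at (snd c q)) \<noteq> (\<lambda>_. 0))))"

text \<open>Timelike hypersurface: the induced metric is Lorentzian.\<close>

definition timelike_boundary ::
  "('s, 'm::finite) manifold \<Rightarrow> ('s \<Rightarrow> 'p) \<Rightarrow> ('p, 'n::finite) spacetime \<Rightarrow> 'p set \<Rightarrow> bool" where
  "timelike_boundary S e M V \<longleftrightarrow>
     smooth_embedding S M e \<and> bounds S e M V \<and>
     (\<forall>k\<in>atlas S. \<forall>c\<in>atlas M. \<forall>y\<in>coord_dom k c e.
        lorentzian_form (first_form (gmetric M c) (coord_rep k c e) y))"

definition points_into :: "('p, 'n) chart \<Rightarrow> 'p set \<Rightarrow> real^'n \<Rightarrow> real^'n \<Rightarrow> bool" where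
  "points_into c V x v \<longleftrightarrow>
     (\<exists>\<epsilon>>0. \<forall>s. 0 < s \<and> s < \<epsilon> \<longrightarrow> x + s *\<^sub>R v \<in> snd c ` (fst c \<inter> V))"


section \<open>Regular junction conditions of metric f(R) gravity\<close>

text \<open>The open regions \<open>V\<close> of \<open>M\<close> (interior) and \<open>E\<close> of \<open>N\<close> (exterior) are glued along \<open>S\<close> by means
  of the two embeddings; tensors along \<open>S\<close> are compared in the same coordinates of \<open>S\<close>.
  On both sides the unit normal is directed from the interior to the exterior;
  along a timelike boundary such a normal exists and is unique.\<close>

definition regular_junction ::
  "('s, 'm::finite) manifold \<Rightarrow> ('p, 'n::finite) spacetime \<Rightarrow> 'p set \<Rightarrow> ('s \<Rightarrow> 'p) \<Rightarrow>
   ('q, 'n::finite) spacetime \<Rightarrow> 'q set \<Rightarrow> ('s \<Rightarrow> 'q) \<Rightarrow> bool" where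
  "regular_junction S M V eM N E eN \<longleftrightarrow>
     (\<forall>p\<in>topspace (mtop S). scalar_curvature N (eN p) = scalar_curvature M (eM p)) \<and>
     (\<forall>k\<in>atlas S. \<forall>c\<in>atlas M. \<forall>d\<in>atlas N. \<forall>p\<in>fst k \<inter> eM -` fst c \<inter> eN -` fst d.
        let y = snd k p; X = coord_rep k c eM; Y = coord_rep k d eN;
            g = gmetric M c; h = gmetric N d
        in first_form h Y y = first_form g X y \<and>
           (\<forall>m n. unit_normal g X y m \<and> points_into c V (X y) (- m) \<and>
                  unit_normal h Y y n \<and> points_into d E (Y y) n \<longrightarrow>
              extrinsic_curvature h Y y n = extrinsic_curvature g X y m \<and>
              frechet_derivative (ricci_scalar h) (at (Y y)) n =
              frechet_derivative (ricci_scalar g) (at (X y)) m))"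


section \<open>The spatially flat FLRW spacetime\<close>

text \<open>Coordinates $(t,x,y,z)$ with \<open>t = x $ 1\<close>; the flat spatial metric $dr^2 + r^2 d\Omega^2$ is
  $dx^2+dy^2+dz^2$, and Cartesian coordinates also cover the points with $r = 0$ and the polar axis
  (see \<open>flrw_metric_spherical\<close>).\<close>

definition flrw_metric :: "(real \<Rightarrow> real) \<Rightarrow> real^4 \<Rightarrow> real^4^4" where
  "flrw_metric a x = (\<chi> i j. if i \<noteq> j then 0 else if i = 1 then -1 else (a (x $ 1))\<^sup>2)"

definition flrw :: "(real \<Rightarrow> real) \<Rightarrow> real set \<Rightarrow> (real^4, 4) spacetime" where
  "flrw a J = \<lparr> mtop = top_of_set {x. x $ 1 \<in> J}, atlas = {({x. x $ 1 \<in> J}, id)},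
                gmetric = (\<lambda>_. flrw_metric a) \<rparr>"

definition spherical :: "real^4 \<Rightarrow> real^4" where
  "spherical u = vector [u$1, u$2 * sin (u$3) * cos (u$4), u$2 * sin (u$3) * sin (u$4),
                         u$2 * cos (u$3)]"

lemma vec4_nth:
  "(vector [p, q, r, s] :: real^4) $ 1 = p" "(vector [p, q, r, s] :: real^4) $ 2 = q"
  "(vector [p, q, r, s] :: real^4) $ 3 = r" "(vector [p, q, r, s] :: real^4) $ 4 = s"
  by (simp_all add: vector_def)

lemma spherical_has_derivative:
  "(spherical has_derivative (\<lambda>v. vector [v$1,
      v$2 * sin (u$3) * cos (u$4) + u$2 * cos (u$3) * v$3 * cos (u$4)
        - u$2 * sin (u$3) * sin (u$4) * v$4,
      v$2 * sin (u$3) * sin (u$4) + u$2 * cos (u$3) * v$3 * sin (u$4)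
        + u$2 * sin (u$3) * cos (u$4) * v$4,
      v$2 * cos (u$3) - u$2 * sin (u$3) * v$3])) (at u)" (is "(_ has_derivative ?D) _")
proof -
  have nth [derivative_intros]: "((\<lambda>x::real^4. x $ i) has_derivative (\<lambda>x. x $ i)) (at u)" for i
    by (rule bounded_linear_imp_has_derivative) (rule bounded_linear_vec_nth)
  have "((\<lambda>x. spherical x $ i) has_derivative (\<lambda>v. ?D v $ i)) (at u)" for i
    using exhaust_4[of i] unfolding spherical_def
    by (elim disjE) (auto simp: vec4_nth intro!: derivative_eq_intros simp: algebra_simps)
  then show ?thesis
    by (subst has_derivative_componentwise_within) (auto simp: Basis_vec_def inner_axis)
qed

lemma flrw_metric_spherical:
  "frechet_derivative spherical (at u) v \<bullet>
     (flrw_metric a (spherical u) *v frechet_derivative spherical (at u) w) =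
   - (v$1 * w$1) +
   (a (u$1))\<^sup>2 * (v$2 * w$2 + (u$2)\<^sup>2 * (v$3 * w$3 + (sin (u$3))\<^sup>2 * (v$4 * w$4)))"
proof -
  have gen: "p \<bullet> (flrw_metric a x *v q) =
      - (p$1 * q$1) + (a (x$1))\<^sup>2 * (p$2 * q$2 + p$3 * q$3 + p$4 * q$4)" for p q x
    by (simp add: flrw_metric_def inner_vec_def matrix_vector_mult_def sum_4 distrib_left)
  have alg: "(v2 * s * c + r * k * v3 * c - r * s * d * v4) * (w2 * s * c + r * k * w3 * c - r * s * d * w4)
     + (v2 * s * d + r * k * v3 * d + r * s * c * v4) * (w2 * s * d + r * k * w3 * d + r * s * c * w4)
     + (v2 * k - r * s * v3) * (w2 * k - r * s * w3)
     = v2 * w2 + r\<^sup>2 * (v3 * w3 + s\<^sup>2 * (v4 * w4))" (is "?L = ?R")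
    if "s\<^sup>2 + k\<^sup>2 = 1" "c\<^sup>2 + d\<^sup>2 = 1" for v2 v3 v4 w2 w3 w4 s k c d r :: real
  proof -
    have "?L = ((v2 * s + r * k * v3) * (w2 * s + r * k * w3) + r\<^sup>2 * s\<^sup>2 * v4 * w4) * (c\<^sup>2 + d\<^sup>2)
        + (v2 * k - r * s * v3) * (w2 * k - r * s * w3)"
      by (simp add: algebra_simps power2_eq_square)
    also have "\<dots> = (v2 * w2 + r\<^sup>2 * v3 * w3) * (s\<^sup>2 + k\<^sup>2) + r\<^sup>2 * s\<^sup>2 * v4 * w4"
      by (simp add: that(2)) (simp add: algebra_simps power2_eq_square)
    also have "\<dots> = ?R"
      by (simp add: that(1)) (simp add: algebra_simps)
    finally show ?thesis .
  qed
  have 1: "spherical u $ 1 = u $ 1"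
    by (simp add: spherical_def vec4_nth)
  show ?thesis
    unfolding frechet_derivative_at[OF spherical_has_derivative, symmetric] gen vec4_nth 1
    by (subst alg) simp_all
qed

lemma matrix_inv_flrw:
  assumes "a (x$1) \<noteq> 0"
  shows "matrix_inv (flrw_metric a x) =
    (\<chi> i j. if i \<noteq> j then 0 else if i = 1 then -1 else 1 / (a (x $ 1))\<^sup>2)"
  (is "_ = ?B")
proof -
  let ?A = "flrw_metric a x"
  have AB: "?A ** ?B = mat 1" "?B ** ?A = mat 1"
    using assms by (auto simp: flrw_metric_def matrix_matrix_mult_def vec_eq_iff
        mat_def forall_4 sum_4)
  then have inv: "matrix_inv ?A ** ?A = mat 1"
    unfolding matrix_inv_def by (intro someI2[where a = ?B and Q = "\<lambda>B. B ** ?A = mat 1"]) blast+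
  have "matrix_inv ?A = matrix_inv ?A ** (?A ** ?B)"
    by (simp only: AB matrix_mul_rid)
  also have "\<dots> = ?B"
    by (simp only: matrix_mul_assoc inv matrix_mul_lid)
  finally show ?thesis .
qed

lemma pd_time:
  fixes F :: "real^4 \<Rightarrow> real"
  assumes "open J" "x $ 1 \<in> J" "\<And>y. y $ 1 \<in> J \<Longrightarrow> F y = h (y $ 1)"
    and "(h has_real_derivative h') (at (x $ 1))"
  shows "pd l F x = (if l = 1 then h' else 0)"
proof -
  have op: "open {y::real^4. y $ 1 \<in> J}"
    using open_vimage_vec_nth[OF assms(1)] by (simp add: vimage_def)
  have nth: "((\<lambda>x::real^4. x $ 1) has_derivative (\<lambda>x. x $ 1)) (at x)"
    by (rule bounded_linear_imp_has_derivative) (rule bounded_linear_vec_nth)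
  have "((\<lambda>y. h (y $ 1)) has_derivative (\<lambda>v. h' * v $ 1)) (at x)"
    using has_derivative_compose[OF nth] assms(4) by (simp add: has_field_derivative_def)
  then have "(F has_derivative (\<lambda>v. h' * v $ 1)) (at x)"
    by (rule has_derivative_transform_within_open[OF _ op]) (use assms in auto)
  then have "frechet_derivative F (at x) = (\<lambda>v. h' * v $ 1)"
    by (rule frechet_derivative_at[symmetric])
  then show ?thesis
    by (simp add: pd_def axis_def)
qed

lemma smooth_on_real_derivs:
  assumes "open J" "smooth_on J a" "t \<in> J"
  shows "(a has_real_derivative deriv a t) (at t)"
    and "(deriv a has_real_derivative deriv (deriv a) t) (at t)"
proof -
  have 2: "Ck_on (Suc (Suc 0)) J a"
    using assms(2) by (simp only: smooth_on_def)
  have d: "(a has_real_derivative deriv a s) (at s)" if "s \<in> J" for s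
    using 2 that by (auto simp: DERIV_deriv_iff_real_differentiable)
  show "(a has_real_derivative deriv a t) (at t)" by (rule d) fact
  have eq: "frechet_derivative a (at s) 1 = deriv a s" if "s \<in> J" for s
    by (simp flip: frechet_derivative_at[OF d[OF that, unfolded has_field_derivative_def]])
  have "(\<lambda>s. frechet_derivative a (at s) 1) differentiable (at t)"
    using 2 assms(3) by simp
  then obtain D where "((\<lambda>s. frechet_derivative a (at s) 1) has_derivative D) (at t)"
    unfolding differentiable_def by blast
  then have "(deriv a has_derivative D) (at t)"
    by (rule has_derivative_transform_within_open[OF _ assms(1,3)]) (simp add: eq)
  then show "(deriv a has_real_derivative deriv (deriv a) t) (at t)"
    unfolding DERIV_deriv_iff_real_differentiable differentiable_def by blast
qed

lemma christoffel_flrw: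
  assumes "open J" "smooth_on J a" "\<And>t. t \<in> J \<Longrightarrow> 0 < a t" "x $ 1 \<in> J"
  shows "christoffel (flrw_metric a) x k i j =
    (if k = 1 then (if i = j \<and> i \<noteq> 1 then a (x$1) * deriv a (x$1) else 0)
     else if i = 1 \<and> j = k \<or> j = 1 \<and> i = k then deriv a (x$1) / a (x$1) else 0)"
proof -
  have pos: "0 < a (x$1)" using assms by blast
  have dg: "pd l (\<lambda>y. flrw_metric a y $ m $ n) x =
      (if l = 1 then (if m = n \<and> m \<noteq> 1 then 2 * a (x$1) * deriv a (x$1) else 0) else 0)" for l m n
  proof (rule pd_time[OF assms(1,4)])
    show "flrw_metric a y $ m $ n =
        (\<lambda>t. if m = n \<and> m \<noteq> 1 then (a t)\<^sup>2 else if m = n then -1 else 0) (y$1)" for y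
      by (simp add: flrw_metric_def)
    show "((\<lambda>t. if m = n \<and> m \<noteq> 1 then (a t)\<^sup>2 else if m = n then -1 else 0)
        has_real_derivative (if m = n \<and> m \<noteq> 1 then 2 * a (x$1) * deriv a (x$1) else 0)) (at (x$1))"
      using smooth_on_real_derivs(1)[OF assms(1,2,4)]
      by (auto intro!: derivative_eq_intros)
  qed
  have inv: "matrix_inv (flrw_metric a x) $ k $ l =
      (if l = k then (if k = 1 then -1 else 1 / (a (x $ 1))\<^sup>2) else 0)" for l
    using pos by (simp add: matrix_inv_flrw)
  let ?G = "\<lambda>i j l. pd i (\<lambda>y. flrw_metric a y $ j $ l) x + pd j (\<lambda>y. flrw_metric a y $ i $ l) x
      - pd l (\<lambda>y. flrw_metric a y $ i $ j) x"
  have "(\<Sum>l\<in>UNIV. matrix_inv (flrw_metric a x) $ k $ l * ?G i j l) =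
      (\<Sum>l\<in>UNIV. if l = k then (if k = 1 then -1 else 1 / (a (x $ 1))\<^sup>2) * ?G i j k else 0)"
    by (intro sum.cong) (auto simp only: inv mult_zero_left split: if_split)
  then have eq: "christoffel (flrw_metric a) x k i j =
      (1/2) * ((if k = 1 then -1 else 1 / (a (x $ 1))\<^sup>2) * ?G i j k)"
    by (simp only: christoffel_def sum.delta finite UNIV_I if_True)
  show ?thesis
    unfolding eq dg using pos
    by (cases "i = 1"; cases "j = 1"; cases "k = 1"; cases "i = j")
      (simp_all add: power2_eq_square)
qed

lemma scalar_curvature_flrw:
  assumes "open J" "smooth_on J a" "\<And>t. t \<in> J \<Longrightarrow> 0 < a t" "x $ 1 \<in> J"
  shows "scalar_curvature (flrw a J) x =
    6 * (deriv (deriv a) (x$1) / a (x$1) + (deriv a (x$1))\<^sup>2 / (a (x$1))\<^sup>2)"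
proof -
  have pos: "0 < a (x$1)" using assms by blast
  note d1 = smooth_on_real_derivs(1)[OF assms(1,2,4)]
  note d2 = smooth_on_real_derivs(2)[OF assms(1,2,4)]
  let ?a = "a (x$1)" and ?b = "deriv a (x$1)" and ?c = "deriv (deriv a) (x$1)"
  have dC: "pd l (\<lambda>y. christoffel (flrw_metric a) y k i j) x =
      (if l = 1 then
        (if k = 1 then (if i = j \<and> i \<noteq> 1 then ?b * ?b + ?a * ?c else 0)
         else if i = 1 \<and> j = k \<or> j = 1 \<and> i = k then (?c * ?a - ?b * ?b) / (?a * ?a) else 0)
       else 0)" for l k i j
  proof (rule pd_time[OF assms(1,4)])
    show "christoffel (flrw_metric a) y k i j =
        (\<lambda>t. if k = 1 then (if i = j \<and> i \<noteq> 1 then a t * deriv a t else 0)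
          else if i = 1 \<and> j = k \<or> j = 1 \<and> i = k then deriv a t / a t else 0) (y$1)"
      if "y $ 1 \<in> J" for y
      using christoffel_flrw[OF assms(1-3) that] by simp
    show "((\<lambda>t. if k = 1 then (if i = j \<and> i \<noteq> 1 then a t * deriv a t else 0)
          else if i = 1 \<and> j = k \<or> j = 1 \<and> i = k then deriv a t / a t else 0) has_real_derivative
        (if k = 1 then (if i = j \<and> i \<noteq> 1 then ?b * ?b + ?a * ?c else 0)
         else if i = 1 \<and> j = k \<or> j = 1 \<and> i = k then (?c * ?a - ?b * ?b) / (?a * ?a) else 0))
        (at (x$1))"
      using pos by (auto intro!: derivative_eq_intros d1 d2)
  qed
  note C = christoffel_flrw[OF assms]
  have inv: "matrix_inv (flrw_metric a x) $ k $ l =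
      (if l = k then (if k = 1 then -1 else 1 / ?a\<^sup>2) else 0)" for k l
    using pos by (simp add: matrix_inv_flrw)
  have ric: "ricci (flrw_metric a) x i i =
      (if i = 1 then - 3 * ?c / ?a else ?a * ?c + 2 * ?b\<^sup>2)" for i
    using exhaust_4[of i] pos
    by (elim disjE) (simp_all add: ricci_def riemann_def sum_4 dC C field_simps power2_eq_square)
  have "ricci_scalar (flrw_metric a) x =
      6 * (?c / ?a + ?b\<^sup>2 / ?a\<^sup>2)"
    using pos by (simp add: ricci_scalar_def inv if_distribR sum_4 ric field_simps power2_eq_square)
  moreover have "(SOME c. c \<in> atlas (flrw a J) \<and> x \<in> fst c) = ({x. x $ 1 \<in> J}, id)"
    by (rule some_equality) (use assms(4) in \<open>auto simp: flrw_def\<close>)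
  ultimately show ?thesis
    by (simp add: scalar_curvature_def flrw_def)
qed


section \<open>The FLRW spacetime is a Lorentzian manifold\<close>

lemma Ck_cong: "open S \<Longrightarrow> Ck_on k S f \<Longrightarrow> (\<And>x. x \<in> S \<Longrightarrow> f x = g x) \<Longrightarrow> Ck_on k S g"
proof (induction k arbitrary: f g)
  case 0 then show ?case by (auto cong: continuous_on_cong)
next
  case (Suc k)
  have d: "(g has_derivative frechet_derivative f (at x)) (at x)" if "x \<in> S" for x
    by (rule has_derivative_transform_within_open[where f=f and s=S])
      (use Suc.prems that in \<open>auto simp: frechet_derivative_works[symmetric]\<close>)
  have e: "frechet_derivative f (at x) = frechet_derivative g (at x)" if "x \<in> S" for x
    using frechet_derivative_at[OF d[OF that]] .
  show ?case
  proof (simp only: Ck_on.simps, intro conjI ballI)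
    fix x assume "x \<in> S" then show "g differentiable at x" using d differentiable_def by blast
  next
    fix b :: 'a assume b: "b \<in> Basis"
    show "Ck_on k S (\<lambda>x. frechet_derivative g (at x) b)"
      by (rule Suc.IH[where f="\<lambda>x. frechet_derivative f (at x) b"]) (use Suc.prems b e in auto)
  qed
qed

lemma Ck_const: "Ck_on k S (\<lambda>_. c)"
  by (induction k arbitrary: c) (simp_all only: Ck_on.simps frechet_derivative_const continuous_on_const differentiable_const ball_triv simp_thms)

lemma Ck_add: "open S \<Longrightarrow> Ck_on k S f \<Longrightarrow> Ck_on k S g \<Longrightarrow> Ck_on k S (\<lambda>x. f x + g x)"
proof (induction k arbitrary: f g)
  case 0 then show ?case by (simp add: continuous_on_add continuous_on_mult)
next
  case (Suc k)
  have d: "((\<lambda>x. f x + g x) has_derivative (\<lambda>v. frechet_derivative f (at x) v + frechet_derivative g (at x) v)) (at x)" if "x \<in> S" for x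
    by (rule has_derivative_add) (use Suc.prems that in \<open>auto simp: frechet_derivative_works[symmetric]\<close>)
  show ?case
  proof (simp only: Ck_on.simps, intro conjI ballI)
    fix x assume "x \<in> S" then show "(\<lambda>x. f x + g x) differentiable at x" using d differentiable_def by blast
  next
    fix b :: 'a assume b: "b \<in> Basis"
    show "Ck_on k S (\<lambda>x. frechet_derivative (\<lambda>x. f x + g x) (at x) b)"
    proof (rule Ck_cong)
      show "Ck_on k S (\<lambda>x. frechet_derivative f (at x) b + frechet_derivative g (at x) b)"
        by (rule Suc.IH) (use Suc.prems b in simp_all)
    qed (use Suc.prems(1) in \<open>auto simp flip: frechet_derivative_at[OF d]\<close>)
  qed
qed

lemma Ck_lin: "open S \<Longrightarrow> bounded_linear L \<Longrightarrow> Ck_on k S f \<Longrightarrow> Ck_on k S (\<lambda>x. L (f x))"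
proof (induction k arbitrary: f)
  case 0 then show ?case by (auto intro: bounded_linear.continuous_on)
next
  case (Suc k)
  have d: "((\<lambda>x. L (f x)) has_derivative (\<lambda>v. L (frechet_derivative f (at x) v))) (at x)" if "x \<in> S" for x
    by (rule bounded_linear.has_derivative[OF Suc.prems(2)]) (use Suc.prems that in \<open>auto simp: frechet_derivative_works[symmetric]\<close>)
  show ?case
  proof (simp only: Ck_on.simps, intro conjI ballI)
    fix x assume "x \<in> S" then show "(\<lambda>x. L (f x)) differentiable at x" using d differentiable_def by blast
  next
    fix b :: 'a assume b: "b \<in> Basis"
    show "Ck_on k S (\<lambda>x. frechet_derivative (\<lambda>x. L (f x)) (at x) b)"
    proof (rule Ck_cong)
      show "Ck_on k S (\<lambda>x. L (frechet_derivative f (at x) b))"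
        by (rule Suc.IH) (use Suc.prems b in simp_all)
    qed (use Suc.prems(1) in \<open>auto simp flip: frechet_derivative_at[OF d]\<close>)
  qed
qed

lemma Ck_Suc: "Ck_on (Suc k) S f \<Longrightarrow> Ck_on k S f"
proof (induction k arbitrary: f)
  case 0
  then have "f differentiable_on S"
    unfolding differentiable_on_def Ck_on.simps(2) by (blast intro: differentiable_at_withinI)
  then show ?case by (simp add: differentiable_imp_continuous_on)
next
  case (Suc k)
  have "\<forall>x\<in>S. f differentiable at x" "\<forall>b\<in>Basis. Ck_on (Suc k) S (\<lambda>x. frechet_derivative f (at x) b)"
    using iffD1[OF Ck_on.simps(2)[of "Suc k"] Suc.prems] by blast+
  note p = this
  show ?case
  proof (simp only: Ck_on.simps(2)[of k], intro conjI ballI)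
    fix b :: 'a assume "b \<in> Basis"
    then show "Ck_on k S (\<lambda>x. frechet_derivative f (at x) b)"
      by (intro Suc.IH p(2)[rule_format])
  qed (use p(1) in blast)
qed

lemma Ck_mult: "open S \<Longrightarrow> Ck_on k S f \<Longrightarrow> Ck_on k S g \<Longrightarrow> Ck_on k S (\<lambda>x. f x * g x :: real)"
proof (induction k arbitrary: f g)
  case 0 then show ?case by (simp add: continuous_on_add continuous_on_mult)
next
  case (Suc k)
  have d: "((\<lambda>x. f x * g x) has_derivative (\<lambda>v. f x * frechet_derivative g (at x) v + frechet_derivative f (at x) v * g x)) (at x)" if "x \<in> S" for x
    by (rule has_derivative_mult) (use Suc.prems that in \<open>auto simp: frechet_derivative_works[symmetric]\<close>)
  show ?case
  proof (simp only: Ck_on.simps, intro conjI ballI)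
    fix x assume "x \<in> S" then show "(\<lambda>x. f x * g x) differentiable at x" using d differentiable_def by blast
  next
    fix b :: 'a assume b: "b \<in> Basis"
    have "Ck_on k S (\<lambda>x. f x * frechet_derivative g (at x) b + frechet_derivative f (at x) b * g x)"
    proof (rule Ck_add)
      show "Ck_on k S (\<lambda>x. f x * frechet_derivative g (at x) b)"
        by (rule Suc.IH[OF _ Ck_Suc]) (use Suc.prems b in simp_all)
      show "Ck_on k S (\<lambda>x. frechet_derivative f (at x) b * g x)"
        by (rule Suc.IH[OF _ _ Ck_Suc]) (use Suc.prems b in simp_all)
    qed (rule Suc.prems(1))
    then show "Ck_on k S (\<lambda>x. frechet_derivative (\<lambda>x. f x * g x) (at x) b)"
      by (rule Ck_cong[OF Suc.prems(1)])
       (auto simp flip: frechet_derivative_at[OF d])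
  qed
qed

lemma Ck_time: "open J \<Longrightarrow> Ck_on k J h \<Longrightarrow> Ck_on k {x::real^4. x$1 \<in> J} (\<lambda>x. h (x $ 1) :: real)"
proof (induction k arbitrary: h)
  case 0 
  have "continuous_on {x::real^4. x$1 \<in> J} (\<lambda>x. x $ 1)" by (intro continuous_intros)
  from continuous_on_compose2[OF _ this, of J h] 0 show ?case by auto
next
  case (Suc k)
  have op: "open {y::real^4. y $ 1 \<in> J}"
    using open_vimage_vec_nth[OF Suc.prems(1)] by (simp add: vimage_def)
  have nth: "((\<lambda>x::real^4. x $ 1) has_derivative (\<lambda>x. x $ 1)) (at x)" for x
    by (rule bounded_linear_imp_has_derivative) (rule bounded_linear_vec_nth)
  have d: "((\<lambda>x::real^4. h (x$1)) has_derivative (\<lambda>v. frechet_derivative h (at (x$1)) (v$1))) (at x)" if "x$1 \<in> J" for x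
    by (rule has_derivative_compose[OF nth]) (use Suc.prems that in \<open>auto simp: frechet_derivative_works[symmetric]\<close>)
  have lin: "frechet_derivative h (at (x$1)) 0 = 0" if "x$1 \<in> J" for x :: "real^4"
    using Suc.prems that linear_frechet_derivative linear_0 by fastforce
  show ?case
  proof (simp only: Ck_on.simps, intro conjI ballI)
    fix x :: "real^4" assume "x \<in> {x. x$1 \<in> J}" then show "(\<lambda>x. h (x$1)) differentiable at x" using d differentiable_def by blast
  next
    fix b :: "real^4" assume b: "b \<in> Basis"
    then have b1: "b $ 1 = 0 \<or> b $ 1 = 1" by (auto simp: Basis_vec_def axis_def)
    have "Ck_on k {x::real^4. x$1 \<in> J} (\<lambda>x. frechet_derivative h (at (x$1)) (b$1))"
    proof (cases "b$1 = 1")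
      case True then show ?thesis using Suc.IH[of "\<lambda>t. frechet_derivative h (at t) 1", OF Suc.prems(1)] Suc.prems by simp
    next
      case False then show ?thesis using b1 lin by (intro Ck_cong[OF op Ck_const[of _ _ 0]]) auto
    qed
    then show "Ck_on k {x::real^4. x$1 \<in> J} (\<lambda>x. frechet_derivative (\<lambda>x. h (x$1)) (at x) b)"
      by (rule Ck_cong[OF op])
       (auto simp flip: frechet_derivative_at[OF d])
  qed
qed

lemma Ck_id: "Ck_on k S (\<lambda>x. x)"
  by (cases k) (auto simp: Ck_const)

lemma flrw_lorentzian:
  assumes J: "open J" and a: "smooth_on J a" "\<And>t. t \<in> J \<Longrightarrow> 0 < a t"
  shows "lorentzian_manifold (flrw a J)"
proof -
  let ?U = "{x::real^4. x$1 \<in> J}"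
  have op: "open ?U"
    using open_vimage_vec_nth[OF J] by (simp add: vimage_def)
  let ?P = "(\<chi> i j. if i = j \<and> i \<noteq> 1 then 1 else 0) :: real^4^4"
  let ?C = "(\<chi> i j. if i = j \<and> i = 1 then -1 else 0) :: real^4^4"
  have "Ck_on k ?U (\<lambda>x. ?C + (a (x$1) * a (x$1)) *\<^sub>R ?P)" for k
    using a(1) unfolding smooth_on_def
    by (rule_tac Ck_add[OF op Ck_const Ck_lin[OF op bounded_linear_scaleR_left Ck_mult[OF op
        Ck_time[OF J] Ck_time[OF J]]]]) blast+
  moreover have "?C + (a (x$1) * a (x$1)) *\<^sub>R ?P = flrw_metric a x" for x
    by (simp add: flrw_metric_def vec_eq_iff power2_eq_square)
  ultimately have sm: "smooth_on ?U (flrw_metric a)" by (simp add: smooth_on_def)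
  have lf: "lorentzian_form (flrw_metric a x)" if "x \<in> ?U" for x
  proof -
    have "a (x$1) \<noteq> 0" using a(2) that by force
    then show ?thesis unfolding lorentzian_form_def
        apply (intro conjI exI[of _ "\<chi> i j. if i \<noteq> j then 0 else if i = 1 then 1 else 1 / a (x$1)"] exI[of _ 1])
      by (auto simp: flrw_metric_def transpose_def matrix_matrix_mult_def vec_eq_iff forall_4 sum_4 power2_eq_square)
  qed
  have cr: "coord_rep (?U, id) (?U, id) id x = x" if "x \<in> ?U" for x
    using f_inv_into_f[of x id ?U] that by (simp add: coord_rep_def)
  have cd: "coord_dom (?U, id) (?U, id) id = ?U" by (auto simp: coord_dom_def)
  have s2: "smooth_on ?U (coord_rep (?U, id) (?U, id) id)"
    unfolding smooth_on_def by (intro allI Ck_cong[OF op Ck_id]) (simp add: cr)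
  have fr: "frechet_derivative (coord_rep (?U, id) (?U, id) id) (at x) = (\<lambda>v. v)" if "x \<in> ?U" for x
    by (rule frechet_derivative_at[symmetric], rule has_derivative_transform_within_open[OF has_derivative_ident op that]) (simp add: cr)
  have sc: "second_countable (top_of_set ?U)"
  proof (rule second_countable_subtopology)
    obtain B :: "(real^4) set set" where "countable B" "\<And>C. C \<in> B \<Longrightarrow> open C"
        "\<And>S. open S \<Longrightarrow> \<exists>U. U \<subseteq> B \<and> S = \<Union>U" by (rule univ_second_countable) blast
    then show "second_countable (euclidean :: (real^4) topology)"
      unfolding second_countable_def by (intro exI[of _ B]) (fastforce simp: open_openin[symmetric])
  qed
  show ?thesis
    unfolding lorentzian_manifold_def smooth_manifold_def
    using sm lf s2 fr cr op sc
    by (auto simp: flrw_def cd  Hausdorff_space_subtopology homeomorphic_map_id subtopology_subtopology)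
qed

end

theory Submission
  imports Defs
begin

text \<open>By continuity the Ricci tensor of the exterior vanishes also on \<open>\<Sigma>\<close>, since every point of \<open>\<Sigma>\<close> is a
  limit of points of the exterior: a defining function of the boundary has a direction of descent there.
  The single condition $[R]^+_- = 0$ then makes the Ricci scalar of the interior vanish on \<open>\<Sigma>\<close>.\<close>

section \<open>Closure of \<open>Ck_on\<close> under finite sums, products, differences and
  reciprocals\<close>

lemma Ck_sum:
  assumes "open S" "\<And>i. i \<in> I \<Longrightarrow> Ck_on k S (f i)"
  shows "Ck_on k S (\<lambda>x. \<Sum>i\<in>I. f i x)"
  using assms(2) by (induction I rule: infinite_finite_induct) (auto intro: Ck_const Ck_add[OF assms(1)])

lemma Ck_prod:
  fixes f :: "'i \<Rightarrow> 'a::euclidean_space \<Rightarrow> real"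
  assumes "open S" "\<And>i. i \<in> I \<Longrightarrow> Ck_on k S (f i)"
  shows "Ck_on k S (\<lambda>x. \<Prod>i\<in>I. f i x)"
  using assms(2) by (induction I rule: infinite_finite_induct) (auto intro: Ck_const Ck_mult[OF assms(1)])

lemma Ck_minus: "open S \<Longrightarrow> Ck_on k S f \<Longrightarrow> Ck_on k S (\<lambda>x. - f x)"
  by (rule Ck_lin[where L = uminus]) (auto intro: bounded_linear_minus bounded_linear_ident)

lemma Ck_diff: "open S \<Longrightarrow> Ck_on k S f \<Longrightarrow> Ck_on k S g \<Longrightarrow> Ck_on k S (\<lambda>x. f x - g x)"
  using Ck_add[OF _ _ Ck_minus] by fastforce

text \<open>The derivative of 1/f is -f'/f^2, in which 1/f occurs undifferentiated. Hence induction
  on the order closes up: 1/f at order k yields its derivative at order k.\<close>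

lemma Ck_inverse:
  fixes f :: "'a::euclidean_space \<Rightarrow> real"
  assumes S: "open S" and "Ck_on k S f" and nz: "\<And>x. x \<in> S \<Longrightarrow> f x \<noteq> 0"
  shows "Ck_on k S (\<lambda>x. inverse (f x))"
  using assms(2)
proof (induction k)
  case 0 then show ?case using nz by (auto intro: continuous_on_inverse)
next
  case (Suc k)
  \<comment> \<open>\<open>Ck_Suc\<close> lowers the order of f by one, so that the induction
    hypothesis applies to f itself.\<close>
  note IH = Suc.IH[OF Ck_Suc[OF Suc.prems]]
  have d: "((\<lambda>x. inverse (f x)) has_derivative
      (\<lambda>v. - (inverse (f x) * frechet_derivative f (at x) v * inverse (f x)))) (at x)" if "x \<in> S" for x
    by (rule Deriv.has_derivative_inverse) (use Suc.prems that nz in \<open>auto simp: frechet_derivative_works[symmetric]\<close>)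
  show ?case
  proof (simp only: Ck_on.simps, intro conjI ballI)
    fix x assume "x \<in> S"
    then show "(\<lambda>x. inverse (f x)) differentiable at x" using d differentiable_def by blast
  next
    fix b :: 'a assume "b \<in> Basis"
    then have "Ck_on k S (\<lambda>x. - (inverse (f x) * frechet_derivative f (at x) b * inverse (f x)))"
      using Suc.prems by (intro Ck_minus Ck_mult S IH) simp
    then show "Ck_on k S (\<lambda>x. frechet_derivative (\<lambda>x. inverse (f x)) (at x) b)"
      by (rule Ck_cong[OF S]) (auto simp flip: frechet_derivative_at[OF d])
  qed
qed

lemma Ck_pd: "Ck_on (Suc k) S f \<Longrightarrow> Ck_on k S (pd i f)"
  unfolding pd_def by (simp add: axis_in_Basis_iff)

lemma Ck_vec_nth: "open S \<Longrightarrow> Ck_on k S f \<Longrightarrow> Ck_on k S (\<lambda>x. f x $ i)"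
  by (rule Ck_lin[OF _ bounded_linear_vec_nth])

section \<open>Regularity of determinants and of inverse matrices\<close>

lemma Ck_det:
  fixes A :: "'a::euclidean_space \<Rightarrow> real^'n^'n"
  assumes "open S" "\<And>i j. Ck_on k S (\<lambda>x. A x $ i $ j)"
  shows "Ck_on k S (\<lambda>x. det (A x))"
  unfolding det_def by (intro Ck_sum Ck_mult Ck_prod Ck_const assms)

text \<open>Column l of the inverse solves A x = e_l, so Cramer's rule applies. The entries become
  quotients of polynomials in the entries of A, which makes their differentiability accessible
  although \<open>matrix_inv\<close> is defined by a choice.\<close>

lemma matrix_inv_cramer:
  fixes A :: "real^'n^'n"
  assumes "det A \<noteq> 0"
  shows "matrix_inv A $ k $ l = det (\<chi> i j. if j = k then axis l 1 $ i else A $ i $ j) * inverse (det A)"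
proof -
  have "A ** matrix_inv A = mat 1"
    using assms someI_ex[of "\<lambda>B. A ** B = mat 1 \<and> B ** A = mat 1"]
    by (simp add: matrix_inv_def flip: invertible_det_nz invertible_def)
  then have "A *v (matrix_inv A *v axis l 1) = axis l 1"
    by (simp add: matrix_vector_mul_assoc)
  then have "matrix_inv A *v axis l 1 = (\<chi> k. det (\<chi> i j. if j = k then axis l 1 $ i else A $ i $ j) / det A)"
    by (simp only: cramer[OF assms])
  moreover have "(matrix_inv A *v axis l 1) $ k = matrix_inv A $ k $ l"
    by (simp add: matrix_vector_mult_basis column_def)
  ultimately show ?thesis by (simp add: divide_inverse)
qed

lemma Ck_matrix_inv:
  fixes A :: "'a::euclidean_space \<Rightarrow> real^'n^'n"
  assumes S: "open S" and A: "Ck_on k S A" and nz: "\<And>x. x \<in> S \<Longrightarrow> det (A x) \<noteq> 0"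
  shows "Ck_on k S (\<lambda>x. matrix_inv (A x) $ i $ j)"
proof (rule Ck_cong[OF S])
  have entry: "Ck_on k S (\<lambda>x. A x $ m $ n)" for m n
    by (intro Ck_vec_nth S A)
  \<comment> \<open>After column i is replaced by a unit vector, each entry is either a constant or
    an entry of A.\<close>
  have "Ck_on k S (\<lambda>x. (\<chi> m n. if n = i then axis j 1 $ m else A x $ m $ n) $ p $ q)" for p q
    using entry[of p q] by (cases "q = i") (simp_all add: Ck_const)
  then show "Ck_on k S (\<lambda>x. det (\<chi> m n. if n = i then axis j 1 $ m else A x $ m $ n) * inverse (det (A x)))"
    by (intro Ck_mult Ck_det Ck_inverse S entry nz)
qed (simp add: matrix_inv_cramer[OF nz])

text \<open>An orthonormal frame P turns A into a diagonal matrix with entries 1 and -1. Its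
  determinant is nonzero and has \<open>det A\<close> as a factor.\<close>

lemma lorentzian_form_det:
  fixes A :: "real^'n^'n"
  shows "lorentzian_form A \<Longrightarrow> det A \<noteq> 0"
proof
  assume "lorentzian_form A" and A: "det A = 0"
  then obtain P :: "real^'n^'n" and k where P: "transpose P ** A ** P = (\<chi> i j. if i \<noteq> j then 0 else if i = k then -1 else 1)"
    unfolding lorentzian_form_def by blast
  have "det (transpose P ** A ** P) \<noteq> 0"
    unfolding P by (subst det_diagonal) auto
  with A show False by (simp add: det_mul)
qed

section \<open>Regularity of the curvature of a metric\<close>

lemma Ck_christoffel:
  assumes S: "open S" and g: "Ck_on (Suc k) S g" and nz: "\<And>x. x \<in> S \<Longrightarrow> det (g x) \<noteq> 0"
  shows "Ck_on k S (\<lambda>x. christoffel g x m i j)"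
  unfolding christoffel_def
  by (intro Ck_mult Ck_const Ck_sum Ck_diff Ck_add Ck_matrix_inv Ck_pd Ck_vec_nth S g Ck_Suc[OF g] nz)

text \<open>One derivative of g enters the Christoffel symbols and another the Riemann tensor, hence
  the loss of two orders.\<close>

lemma Ck_ricci:
  assumes S: "open S" and g: "Ck_on (Suc (Suc k)) S g" and nz: "\<And>x. x \<in> S \<Longrightarrow> det (g x) \<noteq> 0"
  shows "Ck_on k S (\<lambda>x. ricci g x i j)"
  unfolding ricci_def riemann_def
  by (intro Ck_mult Ck_sum Ck_diff Ck_add Ck_pd Ck_christoffel S g Ck_Suc[OF g] nz)

section \<open>Boundary points as limits of points of the region\<close>

lemma neg_side_in_closure:
  fixes G :: "'a::real_normed_vector \<Rightarrow> real"
  assumes "open U" "x \<in> U" "G x = 0" and diff: "G differentiable at x"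
    and nz: "frechet_derivative G (at x) \<noteq> (\<lambda>_. 0)"
  shows "x \<in> closure {y\<in>U. G y < 0}"
proof -
  let ?D = "frechet_derivative G (at x)"
  have D: "(G has_derivative ?D) (at x)"
    using diff by (simp add: frechet_derivative_works)
  then have lin: "linear ?D" by (rule has_derivative_linear)
  \<comment> \<open>A nonzero linear functional is negative at w or at -w, which gives a direction v
    of descent for G.\<close>
  obtain w where "?D w \<noteq> 0" using nz by blast
  then have "?D w < 0 \<or> ?D (- w) < 0"
    by (auto simp: linear_neg[OF lin])
  then obtain v where v: "?D v < 0" by blast
  have "((\<lambda>s. G (x + s *\<^sub>R v)) has_derivative (\<lambda>s. ?D (s *\<^sub>R v))) (at 0)"
    by (rule has_derivative_compose[where g = G]) (auto intro!: derivative_eq_intros D)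
  then have "((\<lambda>s. G (x + s *\<^sub>R v)) has_real_derivative ?D v) (at 0)"
    by (simp add: has_field_derivative_def linear_cmul[OF lin] mult_commute_abs)
  from DERIV_neg_dec_right[OF this v] obtain e where
    e: "0 < e" "\<And>s. 0 < s \<Longrightarrow> s < e \<Longrightarrow> G (x + s *\<^sub>R v) < 0"
    using assms(3) by auto
  \<comment> \<open>The points x + s v with small s > 0 lie in U, have G < 0 and tend to x, so x
    belongs to the closure.\<close>
  have lim: "((\<lambda>s. x + s *\<^sub>R v) \<longlongrightarrow> x) (at_right 0)"
    by (auto intro!: tendsto_eq_intros)
  have "\<forall>\<^sub>F s in at_right 0. x + s *\<^sub>R v \<in> U"
    using lim assms(1,2) by (rule topological_tendstoD)
  moreover have "\<forall>\<^sub>F s in at_right 0. G (x + s *\<^sub>R v) < 0"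
    using e unfolding eventually_at_right_field by auto
  ultimately have "\<forall>\<^sub>F s in at_right 0. x + s *\<^sub>R v \<in> closure {y\<in>U. G y < 0}"
    by eventually_elim (rule subsetD[OF closure_subset], simp)
  then show ?thesis
    by (rule Lim_in_closed_set[OF closed_closure _ _ lim]) simp
qed

text \<open>In chart coordinates the defining function F of the boundary becomes a function G with
  nonzero differential at the given point, and its negative side lies in V. So
  \<open>neg_side_in_closure\<close> applies to G.\<close>

lemma bounds_chart_closure:
  assumes M: "smooth_manifold M" and b: "bounds S e M V" and p: "p \<in> topspace (mtop S)"
    and c: "c \<in> atlas M" and ep: "e p \<in> fst c"
  shows "snd c (e p) \<in> closure (snd c ` (fst c \<inter> V))"
proof -
  obtain W F where W: "openin (mtop M) W" "e p \<in> W"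
    and zero: "e ` topspace (mtop S) \<inter> W = {q\<in>W. F q = (0::real)}"
    and neg: "V \<inter> W = {q\<in>W. F q < 0}"
    and F: "\<forall>c\<in>atlas M. smooth_on (snd c ` (fst c \<inter> W)) (F \<circ> inv_into (fst c) (snd c)) \<and>
           (\<forall>q\<in>fst c \<inter> W. F q = 0 \<longrightarrow>
              frechet_derivative (F \<circ> inv_into (fst c) (snd c)) (at (snd c q)) \<noteq> (\<lambda>_. 0))"
    using bspec[OF b[unfolded bounds_def] p] by (elim exE conjE)
  let ?U = "snd c ` (fst c \<inter> W)" and ?G = "F \<circ> inv_into (fst c) (snd c)"
  have sm: "smooth_on ?U ?G" using bspec[OF F c] by blast
  have nz: "frechet_derivative ?G (at (snd c q)) \<noteq> (\<lambda>_. 0)" if "q \<in> fst c \<inter> W" "F q = 0" for q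
    using bspec[OF F c] that by blast
  have chart: "openin (mtop M) (fst c)" "open (snd c ` fst c)"
    and hom: "homeomorphic_map (subtopology (mtop M) (fst c)) (top_of_set (snd c ` fst c)) (snd c)"
    using M c unfolding smooth_manifold_def by blast+
  have top: "topspace (subtopology (mtop M) (fst c)) = fst c"
    using openin_subset[OF chart(1)] by auto
  have inj: "inj_on (snd c) (fst c)"
    using homeomorphic_imp_injective_map[OF hom] top by simp
  \<comment> \<open>The chart is a homeomorphism onto its image, so \<open>?U\<close> is relatively
    open there; as that image is open in the full space, \<open>?U\<close> is open too.\<close>
  have "openin (subtopology (mtop M) (fst c)) (fst c \<inter> W)"
    using W(1) by (auto simp: openin_subtopology)
  then have "openin (top_of_set (snd c ` fst c)) ?U"
    using homeomorphic_imp_open_map[OF hom] unfolding open_map_def by blast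
  then have U: "open ?U"
    using chart(2) by (rule openin_open_trans)
  have G: "?G (snd c q) = F q" if "q \<in> fst c" for q
    using inj that by simp
  have ep0: "F (e p) = 0" using zero W(2) p by blast
  have x: "snd c (e p) \<in> ?U" using W(2) ep by blast
  have "Ck_on (Suc 0) ?U ?G" using sm unfolding smooth_on_def by blast
  then have "?G differentiable at (snd c (e p))"
    using x unfolding Ck_on.simps by blast
  moreover have "?G (snd c (e p)) = 0"
    using G[OF ep] ep0 by simp
  ultimately have "snd c (e p) \<in> closure {y\<in>?U. ?G y < 0}"
    using ep0 nz[of "e p"] ep W(2) by (intro neg_side_in_closure[OF U x]) blast+
  moreover have "{y\<in>?U. ?G y < 0} \<subseteq> snd c ` (fst c \<inter> V)"
    using G neg by auto
  ultimately show ?thesis using closure_mono by blast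
qed

text \<open>The point \<open>e p\<close> lies on the boundary of E, where flatness is not assumed.
  The Ricci components in a chart are continuous and vanish along a sequence from E, hence also in
  the limit.\<close>

lemma scalar_curvature_ricci_flat_boundary:
  assumes N: "lorentzian_manifold N" and flat: "ricci_flat_on N E"
    and b: "bounds S e N E" and p: "p \<in> topspace (mtop S)" and ep: "e p \<in> topspace (mtop N)"
  shows "scalar_curvature N (e p) = 0"
proof -
  have man: "smooth_manifold N" using N by (simp add: lorentzian_manifold_def)
  \<comment> \<open>This is the chart that \<open>scalar_curvature\<close> itself selects at
    \<open>e p\<close>, so the Ricci scalar can be evaluated in it at the end.\<close>
  define c where "c = (SOME c. c \<in> atlas N \<and> e p \<in> fst c)"
  have "\<exists>c. c \<in> atlas N \<and> e p \<in> fst c"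
    using man ep unfolding smooth_manifold_def by blast
  then have c: "c \<in> atlas N" "e p \<in> fst c"
    unfolding c_def by (metis (mono_tags, lifting) someI_ex)+
  let ?g = "gmetric N c" and ?X = "snd c ` fst c"
  have X: "open ?X" using man c(1) unfolding smooth_manifold_def by blast
  have "smooth_on ?X ?g" and lf: "\<forall>x\<in>?X. lorentzian_form (?g x)"
    using N c(1) unfolding lorentzian_manifold_def by blast+
  then have g: "Ck_on (Suc (Suc 0)) ?X ?g" unfolding smooth_on_def by blast
  have nz: "det (?g x) \<noteq> 0" if "x \<in> ?X" for x
    using lf that by (intro lorentzian_form_det) blast
  have cl: "snd c (e p) \<in> closure (snd c ` (fst c \<inter> E))"
    using bounds_chart_closure[OF man b p c] .
  have "ricci ?g (snd c (e p)) i j = 0" for i j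
  proof -
    \<comment> \<open>The case k = 0 of \<open>Ck_ricci\<close>: a twice continuously differentiable
      metric has a continuous Ricci tensor.\<close>
    have cont: "isCont (\<lambda>x. ricci ?g x i j) (snd c (e p))"
      using Ck_ricci[OF X g nz] X c(2) by (auto simp: continuous_on_eq_continuous_at)
    obtain x where x: "\<And>n. x n \<in> snd c ` (fst c \<inter> E)" "x \<longlonglongrightarrow> snd c (e p)"
      using cl unfolding closure_sequential by blast
    have "(\<lambda>n. ricci ?g (x n) i j) \<longlonglongrightarrow> ricci ?g (snd c (e p)) i j"
      by (rule isCont_tendsto_compose[OF cont x(2)])
    moreover have "ricci ?g (x n) i j = 0" for n
      using x(1)[of n] flat c(1) unfolding ricci_flat_on_def by auto
    ultimately show ?thesis by (simp add: LIMSEQ_const_iff)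
  qed
  then show ?thesis
    by (simp add: scalar_curvature_def ricci_scalar_def flip: c_def)
qed

theorem proposition4:
  fixes a :: "real \<Rightarrow> real" and J :: "real set" and V :: "(real^4) set"
    and N :: "('q, 4) spacetime" and E :: "'q set"
    and f :: "real \<Rightarrow> real" and D :: "real set"
  assumes "open J" and "is_interval J"
    and "smooth_on J a" and "\<forall>t\<in>J. 0 < a t"
    and "openin (mtop (flrw a J)) V"
    and "\<forall>x\<in>topspace (mtop (flrw a J)). scalar_curvature (flrw a J) x \<noteq> 0"
    and "lorentzian_manifold N"
    and "openin (mtop N) E" and "ricci_flat_on N E"
    and "open D" and "smooth_on D f"
  shows "\<not> (\<exists>(S :: ('s, 3) manifold) eM eN.
     smooth_manifold S \<and> topspace (mtop S) \<noteq> {} \<and>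
     timelike_boundary S eM (flrw a J) V \<and> timelike_boundary S eN N E \<and>
     (\<forall>p\<in>topspace (mtop S).
        scalar_curvature (flrw a J) (eM p) \<in> D \<and> scalar_curvature N (eN p) \<in> D \<and>
        deriv (deriv f) (scalar_curvature (flrw a J) (eM p)) \<noteq> 0 \<and>
        deriv (deriv f) (scalar_curvature N (eN p)) \<noteq> 0) \<and>
     regular_junction S (flrw a J) V eM N E eN)"
proof (intro notI, elim exE conjE)
  fix S :: "('s, 3) manifold" and eM eN
  assume "topspace (mtop S) \<noteq> {}" and M: "timelike_boundary S eM (flrw a J) V"
    and N: "timelike_boundary S eN N E" and junction: "regular_junction S (flrw a J) V eM N E eN"
  then obtain p where p: "p \<in> topspace (mtop S)" by blast
  have emb: "embedding_map (mtop S) (mtop (flrw a J)) eM" "embedding_map (mtop S) (mtop N) eN"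
    using M N unfolding timelike_boundary_def smooth_embedding_def by blast+
  \<comment> \<open>An embedding is a homeomorphism onto its image as a subspace, so its values lie
    in the target space.\<close>
  have top: "eM p \<in> topspace (mtop (flrw a J))" "eN p \<in> topspace (mtop N)"
    using emb[unfolded embedding_map_def, THEN homeomorphic_imp_surjective_map] p by auto
  have "scalar_curvature (flrw a J) (eM p) = scalar_curvature N (eN p)"
    using junction p unfolding regular_junction_def by simp
  also have "\<dots> = 0"
    using N unfolding timelike_boundary_def
    by (intro scalar_curvature_ricci_flat_boundary[where S = S and E = E] assms(7,9) p top(2)) blast
  \<comment> \<open>The interior Ricci scalar is nonzero at every point of the FLRW spacetime, in
    particular at \<open>eM p\<close>.\<close>
  finally show False using assms(6) top(1) by blast
qed

end
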